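(* Every bounded line (line segment) can be extended to an arbitrary length by a match-stick construction following Postulates i, ii and iii below.
   Context: We work in the Euclidean plane with a fixed unit of length. A match-stick (or stick) is a closed line segment of length exactly $1$; its endpoints are called its extremities. A match-stick construction is a finite sequence of steps, starting from given objects, each permitted by the following postulates ("given" means initially given or obtained in an earlier step): Postulate i. One may lay a match-stick through any two given points at distance equal to or less than the unit, where one or even two of the points may be chosen as extremity of the stick segment. This procedure also permits us to determine whether the distance of two given points is strictly less than, equal to, or strictly greater than the unit. Postulate ii. One may choose an arbitrary point on a given stick segment, and it can be chosen such that it is none of the extremities. Postulate iii. From a given point, one may use a match-stick as a unitary ruler. This ruler does not leave a trace, but can be used to determine a point with unit distance to the given point and relatively to a given set of match-sticks (for instance, the points of given sticks at distance exactly $1$ from the given point, or that there are none). No two match-sticks can be used as a compass at the same time. Intersection points of laid sticks count as constructed points. As usual for geometric constructions, "arbitrary" choices are auxiliary. A bounded line is given by laid match-sticks; extending it means laying further sticks along the same straight line so that the covered segment becomes as long as desired. *)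

theory Defs
  imports "HOL-Analysis.Analysis"
begin

type_synonym point = "real^2"

text \<open>A stick is stored as the pair of its extremities, so that both can be referred to;
  the point set it occupies is \<open>seg\<close>.\<close>

type_synonym stick = "point \<times> point"

definition is_stick :: "stick \<Rightarrow> bool" where
  "is_stick s \<longleftrightarrow> dist (fst s) (snd s) = 1"

definition seg :: "stick \<Rightarrow> point set" where
  "seg s = closed_segment (fst s) (snd s)"

text \<open>The ways of laying a stick through two given points: with neither point, the first
  point, or both points prescribed as extremities. (Prescribing the second point amounts to
  exchanging the two points.)\<close>

datatype placement = Through | From_First | Between

fun laid :: "placement \<Rightarrow> point \<Rightarrow> point \<Rightarrow> stick \<Rightarrow> bool" where
  "laid Through p q s \<longleftrightarrow> is_stick s \<and> p \<in> seg s \<and> q \<in> seg s"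
| "laid From_First p q s \<longleftrightarrow> is_stick s \<and> fst s = p \<and> q \<in> seg s"
| "laid Between p q s \<longleftrightarrow> is_stick s \<and> s = (p, q)"

fun layable :: "placement \<Rightarrow> point \<Rightarrow> point \<Rightarrow> bool" where
  "layable Through p q \<longleftrightarrow> p \<noteq> q \<and> dist p q \<le> 1"
| "layable From_First p q \<longleftrightarrow> p \<noteq> q \<and> dist p q \<le> 1"
| "layable Between p q \<longleftrightarrow> dist p q = 1"

text \<open>A construction is a plan of steps that refers to the given objects only by their
  position in the list of given points and the list of given sticks. It receives no coordinates:
  it can branch only on what the postulates allow one to observe. Newly obtained points and
  sticks are appended to the lists.

  \<open>Compare\<close> tells whether the distance of two points is less than, equal to or greater
  than the unit. \<open>Ruler\<close> is the use of a stick as a unitary ruler from a single given point; since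
  it has one centre, it does not allow intersecting two unit circles.
  The continuation of \<open>Ruler\<close> depends on the number of points found.\<close>

datatype construction =
    Stop
  | Lay placement nat nat construction
  | Compare nat nat construction construction construction
  | Choose nat construction
  | Choose_Inner nat construction
  | Ruler nat "nat list" "nat \<Rightarrow> construction"
  | Intersect nat nat construction construction

text \<open>\<open>always_yields c ps ss Q\<close>: starting from the given points \<open>ps\<close> and sticks \<open>ss\<close>, every step of
  \<open>c\<close> can be carried out, and whatever is taken for the arbitrary choices, the points
  and sticks given at the end satisfy \<open>Q\<close>. Everything a step leaves open (the position of a stick
  that is not determined, a chosen point, the order in which several new points are
  listed) is therefore universally quantified.

  \<open>Ruler i js\<close> finds all points of the sticks \<open>js\<close> at distance exactly 1 from point \<open>i\<close>; these are
  finitely many, so a list \<open>xs\<close> of them always exists. Two sticks overlapping in a segment of positive length have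
  no intersection point in the sense of \<open>Intersect\<close>; the ends of the overlap are extremities.\<close>

primrec always_yields ::
  "construction \<Rightarrow> point list \<Rightarrow> stick list \<Rightarrow> (point list \<Rightarrow> stick list \<Rightarrow> bool) \<Rightarrow> bool" where
  "always_yields Stop ps ss Q \<longleftrightarrow> Q ps ss"
| "always_yields (Lay m i j c) ps ss Q \<longleftrightarrow>
     i < length ps \<and> j < length ps \<and> layable m (ps ! i) (ps ! j) \<and>
     (\<forall>s. laid m (ps ! i) (ps ! j) s \<longrightarrow> always_yields c (ps @ [fst s, snd s]) (ss @ [s]) Q)"
| "always_yields (Compare i j c_less c_eq c_greater) ps ss Q \<longleftrightarrow>
     i < length ps \<and> j < length ps \<and>
     (if dist (ps ! i) (ps ! j) < 1 then always_yields c_less ps ss Q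
      else if dist (ps ! i) (ps ! j) = 1 then always_yields c_eq ps ss Q
      else always_yields c_greater ps ss Q)"
| "always_yields (Choose k c) ps ss Q \<longleftrightarrow>
     k < length ss \<and> (\<forall>x \<in> seg (ss ! k). always_yields c (ps @ [x]) ss Q)"
| "always_yields (Choose_Inner k c) ps ss Q \<longleftrightarrow>
     k < length ss \<and>
     (\<forall>x \<in> seg (ss ! k) - {fst (ss ! k), snd (ss ! k)}. always_yields c (ps @ [x]) ss Q)"
| "always_yields (Ruler i ks c) ps ss Q \<longleftrightarrow>
     i < length ps \<and> (\<forall>k \<in> set ks. k < length ss) \<and>
     (\<forall>xs. distinct xs \<and> set xs = (\<Union>k \<in> set ks. sphere (ps ! i) 1 \<inter> seg (ss ! k)) \<longrightarrow>
           always_yields (c (length xs)) (ps @ xs) ss Q)"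
| "always_yields (Intersect k l c_none c_point) ps ss Q \<longleftrightarrow>
     k < length ss \<and> l < length ss \<and>
     (if \<exists>x. seg (ss ! k) \<inter> seg (ss ! l) = {x}
      then always_yields c_point (ps @ [THE x. seg (ss ! k) \<inter> seg (ss ! l) = {x}]) ss Q
      else always_yields c_none ps ss Q)"

definition extremities :: "stick list \<Rightarrow> point list" where
  "extremities ss = concat (map (\<lambda>s. [fst s, snd s]) ss)"

definition bounded_line :: "stick set \<Rightarrow> point \<Rightarrow> point \<Rightarrow> bool" where
  "bounded_line S A B \<longleftrightarrow>
     finite S \<and> S \<noteq> {} \<and> (\<forall>s \<in> S. is_stick s) \<and> (\<Union>s \<in> S. seg s) = closed_segment A B"

text \<open>Among the sticks \<open>ss'\<close>, the sticks \<open>S\<close> and further ones cover a segment of length at least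
  \<open>L\<close>. As \<open>S\<close> is nonempty and part of the longer line, the two lie on the same straight line.\<close>

definition extended_to_length :: "stick set \<Rightarrow> real \<Rightarrow> stick list \<Rightarrow> bool" where
  "extended_to_length S L ss' \<longleftrightarrow>
     (\<exists>T A' B'. S \<subseteq> T \<and> T \<subseteq> set ss' \<and> bounded_line T A' B' \<and> L \<le> dist A' B')"

end

theory Submission
  imports Defs
begin

text \<open>Extending a line beyond its end \<open>B\<close> by a controlled amount needs a second point of the line
  that lies beyond \<open>B\<close>. An arbitrary inner point \<open>X\<close> of the last stick supplies one: a stick laid
  from \<open>X\<close> through \<open>B\<close> is longer than \<open>dist X B\<close>, so its far end \<open>X'\<close> lies strictly beyond \<open>B\<close>.
  How far beyond depends on the choice of \<open>X\<close> and may be arbitrarily little, so that repeating this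
  step alone need not reach a prescribed length. But a further stick, laid from \<open>B\<close> through \<open>X'\<close>,
  prolongs the line by exactly one unit, whatever \<open>X\<close> was. Its far end is the new end of the line
  and it is the new last stick; so \<open>L\<close> rounded up is a sufficient number of repetitions,
  fixed in advance. The process can start because an end of a segment that is a union of sticks is an
  extremity of one of them (\<open>end_is_extremity\<close>); one round is \<open>bounded_line_prolong\<close>.\<close>

lemma closed_segment_outer_trans:
  fixes a b c d :: "'a::euclidean_space"
  assumes "b \<in> closed_segment a c" "c \<in> closed_segment b d" "b \<noteq> c"
  shows "b \<in> closed_segment a d"
proof -
  obtain u where u: "0 \<le> u" "u \<le> 1" "b = (1 - u) *\<^sub>R a + u *\<^sub>R c"
    using assms(1) by (auto simp: in_segment)
  obtain v where v: "0 \<le> v" "c = (1 - v) *\<^sub>R b + v *\<^sub>R d"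
    using assms(2) by (auto simp: in_segment)
  have "u < 1" using u assms(3) by (cases "u = 1") auto
  then have pos: "0 < 1 - u + u * v" using u(1) v(1) by (simp add: add_pos_nonneg)
  \<comment> \<open>Substituting \<open>c\<close> in the equation for \<open>b\<close> and solving for \<open>b\<close>.\<close>
  have eq: "(1 - u + u * v) *\<^sub>R b = (1 - u) *\<^sub>R a + (u * v) *\<^sub>R d"
  proof -
    have "b = (1 - u) *\<^sub>R a + u *\<^sub>R ((1 - v) *\<^sub>R b + v *\<^sub>R d)" using u(3) v(2) by simp
    then show ?thesis by (simp add: algebra_simps)
  qed
  define w where "w = u * v / (1 - u + u * v)"
  have w: "1 - w = (1 - u) / (1 - u + u * v)"
    using pos by (simp add: w_def field_simps)
  have "b = (1 / (1 - u + u * v)) *\<^sub>R ((1 - u + u * v) *\<^sub>R b)" using pos by simp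
  also have "\<dots> = (1 - w) *\<^sub>R a + w *\<^sub>R d"
    unfolding eq w by (simp add: w_def scaleR_add_right)
  finally have "b = (1 - w) *\<^sub>R a + w *\<^sub>R d" .
  moreover have "0 \<le> w" "w \<le> 1"
    using pos u(1) v(1) \<open>u < 1\<close> by (simp_all add: w_def)
  ultimately show ?thesis by (auto simp: in_segment)
qed

text \<open>An end of a segment is an extreme point of it, so it is inner to no stick lying in the
  segment.\<close>

lemma end_is_extremity:
  assumes "bounded_line S A B"
  obtains s where "s \<in> S" "B = fst s \<or> B = snd s"
proof -
  have un: "(\<Union>s\<in>S. seg s) = closed_segment A B"
    using assms by (simp add: bounded_line_def)
  then obtain s where s: "s \<in> S" "B \<in> seg s"
    by (metis UN_E ends_in_segment(2))
  have "seg s \<subseteq> closed_segment A B"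
    using un s(1) by blast
  then have "fst s \<in> closed_segment A B" "snd s \<in> closed_segment A B"
    by (auto simp: seg_def)
  moreover have "B extreme_point_of closed_segment A B"
    by (simp add: extreme_point_of_segment)
  ultimately have "B \<notin> open_segment (fst s) (snd s)"
    by (simp add: extreme_point_of_def)
  with s have "B = fst s \<or> B = snd s"
    by (auto simp: seg_def open_segment_def)
  with s(1) show ?thesis by (rule that)
qed

lemma inner_point_near_extremity:
  assumes "is_stick s" "B = fst s \<or> B = snd s" "X \<in> seg s - {fst s, snd s}"
  shows "X \<noteq> B" "dist X B < 1"
proof -
  show "X \<noteq> B" using assms by auto
  have "X \<in> open_segment (fst s) (snd s)"
    using assms(3) by (auto simp: seg_def open_segment_def)
  then show "dist X B < 1"
    using assms(1,2) dist_in_open_segment[of X "fst s" "snd s"] by (auto simp: is_stick_def)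
qed

text \<open>Here \<open>(X, X')\<close> and \<open>(B, B')\<close> are the sticks laid in one round. The inequality \<open>X \<noteq> B\<close> fixes the
  direction of the first and \<open>X' \<noteq> B\<close> that of the second: both point away from \<open>A\<close>. The latter holds
  for a stick \<open>(X, X')\<close> as soon as \<open>dist X B < 1\<close>.\<close>

lemma bounded_line_prolong:
  assumes line: "bounded_line S A B"
    and X: "X \<in> closed_segment A B" "X \<noteq> B"
    and X': "B \<in> closed_segment X X'" "X' \<noteq> B"
    and B': "X' \<in> closed_segment B B'" "dist B B' = 1"
  shows "bounded_line (insert (B, B') S) A B'" "dist A B' = dist A B + 1"
proof -
  have "B \<in> closed_segment X' A"
    using closed_segment_outer_trans[of B X' X A] X X' by (simp add: closed_segment_commute)
  then have B: "B \<in> closed_segment A B'"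
    using closed_segment_outer_trans[of B A X' B'] X' B' by (simp add: closed_segment_commute)
  then have "closed_segment A B \<union> closed_segment B B' = closed_segment A B'"
    by (simp add: Un_closed_segment)
  then show "bounded_line (insert (B, B') S) A B'"
    using line B'(2) by (auto simp: bounded_line_def is_stick_def seg_def)
  show "dist A B' = dist A B + 1"
    using B B'(2) by (simp add: between_mem_segment[symmetric] between)
qed

text \<open>The line prolonged \<open>n\<close> times at the point number \<open>j\<close>, an extremity of the stick number \<open>k\<close>,
  when \<open>p\<close> points and \<open>q\<close> sticks are given. A round appends the points \<open>X, X, X', B, B'\<close> and
  the sticks \<open>(X, X'), (B, B')\<close>, in this order.\<close>

primrec prolong :: "nat \<Rightarrow> nat \<Rightarrow> nat \<Rightarrow> nat \<Rightarrow> nat \<Rightarrow> construction" where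
  "prolong 0 j k p q = Stop"
| "prolong (Suc n) j k p q =
     Choose_Inner k (Lay From_First p j (Lay From_First j (p + 2)
       (prolong n (p + 4) (q + 1) (p + 5) (q + 2))))"

text \<open>The set \<open>T\<close> holds the sticks that make up the current line. It grows by \<open>(B, B')\<close> alone in each
  round: the auxiliary stick \<open>(X, X')\<close> lies along the prolonged line already.\<close>

lemma always_yields_prolong:
  assumes "S \<subseteq> T" "T \<subseteq> set ss" "bounded_line T A (ps ! j)"
    and "j < length ps" "k < length ss" "ss ! k \<in> T"
    and "ps ! j = fst (ss ! k) \<or> ps ! j = snd (ss ! k)"
    and "L \<le> dist A (ps ! j) + real n"
  shows "always_yields (prolong n j k (length ps) (length ss)) ps ss
           (\<lambda>ps' ss'. extended_to_length S L ss')"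
  using assms
proof (induction n arbitrary: T ps ss j k)
  case 0
  then show ?case by (auto simp: extended_to_length_def)
next
  case (Suc n)
  let ?B = "ps ! j"
  have stick: "is_stick (ss ! k)" and sub: "seg (ss ! k) \<subseteq> closed_segment A ?B"
    using Suc.prems(3,6) by (auto simp: bounded_line_def)
  show ?case
  proof (simp only: prolong.simps always_yields.simps, intro conjI ballI)
    show "k < length ss" by fact
  next
    fix X assume X: "X \<in> seg (ss ! k) - {fst (ss ! k), snd (ss ! k)}"
    note near = inner_point_near_extremity[OF stick Suc.prems(7) X]
    let ?p = "length ps"
    show "?p < length (ps @ [X])" "j < length (ps @ [X])"
      "layable From_First ((ps @ [X]) ! ?p) ((ps @ [X]) ! j)"
      using near Suc.prems(4) by (simp_all add: nth_append)
    show "\<forall>s. laid From_First ((ps @ [X]) ! ?p) ((ps @ [X]) ! j) s \<longrightarrow>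
      j < length ((ps @ [X]) @ [fst s, snd s]) \<and>
      ?p + 2 < length ((ps @ [X]) @ [fst s, snd s]) \<and>
      layable From_First (((ps @ [X]) @ [fst s, snd s]) ! j)
        (((ps @ [X]) @ [fst s, snd s]) ! (?p + 2)) \<and>
      (\<forall>t. laid From_First (((ps @ [X]) @ [fst s, snd s]) ! j)
        (((ps @ [X]) @ [fst s, snd s]) ! (?p + 2)) t \<longrightarrow>
        always_yields (prolong n (?p + 4) (length ss + 1) (?p + 5) (length ss + 2))
          (((ps @ [X]) @ [fst s, snd s]) @ [fst t, snd t]) ((ss @ [s]) @ [t])
          (\<lambda>ps' ss'. extended_to_length S L ss'))"
    proof (intro allI impI, goal_cases)
      case (1 s)
      let ?X' = "snd s" and ?ps = "(ps @ [X]) @ [fst s, snd s]"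
      have s: "dist X ?X' = 1" "?B \<in> closed_segment X ?X'"
        using 1 Suc.prems(4) by (auto simp: nth_append is_stick_def seg_def)
      have "?X' \<noteq> ?B" using s(1) near(2) by auto
      moreover have "dist ?B ?X' \<le> 1"
        using s dist_in_closed_segment[of ?B X ?X'] by simp
      moreover have nth: "?ps ! j = ?B" "?ps ! (?p + 2) = ?X'"
        using Suc.prems(4) by (simp_all add: nth_append)
      moreover have "always_yields (prolong n (?p + 4) (length ss + 1) (?p + 5) (length ss + 2))
          (?ps @ [fst t, snd t]) ((ss @ [s]) @ [t]) (\<lambda>ps' ss'. extended_to_length S L ss')"
        if "laid From_First (?ps ! j) (?ps ! (?p + 2)) t" for t
      proof -
        let ?ps' = "?ps @ [fst t, snd t]" and ?ss' = "(ss @ [s]) @ [t]"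
        have t: "fst t = ?B" "dist ?B (snd t) = 1" "?X' \<in> closed_segment ?B (snd t)"
          using that unfolding nth by (auto simp: is_stick_def seg_def)
        have t_eq: "t = (?B, snd t)"
          using t(1) by (metis prod.collapse)
        have "X \<in> closed_segment A ?B" using X sub by blast
        note line = bounded_line_prolong[OF Suc.prems(3) this near(1) s(2) \<open>?X' \<noteq> ?B\<close> t(3,2),
            folded t_eq]
        have idx: "?ps' ! (?p + 4) = snd t" "?ss' ! (length ss + 1) = t"
          by (simp_all add: nth_append)
        have "always_yields (prolong n (?p + 4) (length ss + 1) (length ?ps') (length ?ss'))
            ?ps' ?ss' (\<lambda>ps' ss'. extended_to_length S L ss')"
        proof (rule Suc.IH[where T = "insert t T"])
          show "S \<subseteq> insert t T" "insert t T \<subseteq> set ?ss'"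
            using Suc.prems(1,2) by auto
          show "bounded_line (insert t T) A (?ps' ! (?p + 4))"
            using line(1) by (simp only: idx)
          show "L \<le> dist A (?ps' ! (?p + 4)) + real n"
            using line(2) Suc.prems(8) by (simp only: idx)
        qed (simp_all only: idx, simp_all)
        then show ?thesis by (simp add: numeral_eq_Suc)
      qed
      ultimately show ?case using Suc.prems(4) by auto
    qed
  qed
qed

theorem proposition1:
  fixes ss :: "stick list" and A B :: point and L :: real
  assumes "bounded_line (set ss) A B"
  shows "\<exists>c. always_yields c (extremities ss) ss (\<lambda>ps' ss'. extended_to_length (set ss) L ss')"
proof -
  obtain s where s: "s \<in> set ss" "B = fst s \<or> B = snd s"
    using end_is_extremity[OF assms] .
  then obtain k where k: "k < length ss" "ss ! k = s"
    by (auto simp: in_set_conv_nth)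
  have "B \<in> set (extremities ss)"
    using s by (auto simp: extremities_def)
  then obtain j where j: "j < length (extremities ss)" "extremities ss ! j = B"
    by (auto simp: in_set_conv_nth)
  obtain n :: nat where "L \<le> real n"
    using real_arch_simple by blast
  then have "L \<le> dist A B + real n"
    by (smt (verit) zero_le_dist)
  with assms s j k show ?thesis
    by (intro exI[of _ "prolong n j k (length (extremities ss)) (length ss)"]
        always_yields_prolong[where T = "set ss"]) auto
qed

end
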